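(* If a snark $G$ contains a heavy pentagon, then $G$ has a cycle cover of length at most $\frac{4}{3}|E(G)|+1$, i.e. $\mathrm{scc}(G)\le \frac{4}{3}|E(G)|+1$.
   Context: Graphs are finite; loops and multiple edges are allowed. A snark is a $2$-connected cubic graph with no proper $3$-edge-colouring. A pentagon (circuit of length $5$) $D$ in $G$ is heavy if $D$ contains an edge $uv$ such that the graph $G-\{u,v\}$ admits a proper $3$-edge-colouring. A cycle is a subgraph in which every vertex has even degree; a cycle cover is a collection of cycles covering every edge; its length is the sum of the numbers of edges of its cycles; $\mathrm{scc}(G)$ is the minimum length of a cycle cover of $G$. *)

theory Defs
  imports Complex_Main "HOL-Library.Multiset"
begin

text \<open>A (finite) multigraph with loops and multiple edges: vertex set V, edge set E,
and an incidence map assigning to each edge the 2-element multiset of its endpoints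
(a loop at v has endpoints {#v,v#}).\<close>

definition multigraph :: "'v set \<Rightarrow> 'e set \<Rightarrow> ('e \<Rightarrow> 'v multiset) \<Rightarrow> bool" where
  "multigraph V E ends \<longleftrightarrow> finite V \<and> finite E \<and>
     (\<forall>e\<in>E. size (ends e) = 2 \<and> set_mset (ends e) \<subseteq> V)"

text \<open>Degree of v with respect to an edge set F (loops count twice).\<close>
definition deg_in :: "'e set \<Rightarrow> ('e \<Rightarrow> 'v multiset) \<Rightarrow> 'v \<Rightarrow> nat" where
  "deg_in F ends v = (\<Sum>e\<in>F. count (ends e) v)"

definition cubic :: "'v set \<Rightarrow> 'e set \<Rightarrow> ('e \<Rightarrow> 'v multiset) \<Rightarrow> bool" where
  "cubic V E ends \<longleftrightarrow> (\<forall>v\<in>V. deg_in E ends v = 3)"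

definition adj_in :: "'e set \<Rightarrow> ('e \<Rightarrow> 'v multiset) \<Rightarrow> 'v set \<Rightarrow> 'v \<Rightarrow> 'v \<Rightarrow> bool" where
  "adj_in E ends S u v \<longleftrightarrow> u \<in> S \<and> v \<in> S \<and> (\<exists>e\<in>E. ends e = {#u, v#})"

definition connected_on :: "'e set \<Rightarrow> ('e \<Rightarrow> 'v multiset) \<Rightarrow> 'v set \<Rightarrow> bool" where
  "connected_on E ends S \<longleftrightarrow> S \<noteq> {} \<and>
     (\<forall>u\<in>S. \<forall>v\<in>S. (adj_in E ends S)\<^sup>*\<^sup>* u v)"

text \<open>2-connected (Diestel): more than 2 vertices, and G - X is connected whenever |X| < 2.\<close>
definition two_connected :: "'v set \<Rightarrow> 'e set \<Rightarrow> ('e \<Rightarrow> 'v multiset) \<Rightarrow> bool" where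
  "two_connected V E ends \<longleftrightarrow> card V > 2 \<and> connected_on E ends V \<and>
     (\<forall>x\<in>V. connected_on E ends (V - {x}))"

text \<open>Proper 3-edge-colouring of the graph (V, E): colours 0,1,2; at each vertex
each colour is used at most once (counting multiplicity, so loops are never allowed).\<close>
definition three_edge_colourable :: "'v set \<Rightarrow> 'e set \<Rightarrow> ('e \<Rightarrow> 'v multiset) \<Rightarrow> bool" where
  "three_edge_colourable V E ends \<longleftrightarrow>
     (\<exists>c :: 'e \<Rightarrow> nat. (\<forall>e\<in>E. c e < 3) \<and>
        (\<forall>v\<in>V. \<forall>k. deg_in {e\<in>E. c e = k} ends v \<le> 1))"

definition snark :: "'v set \<Rightarrow> 'e set \<Rightarrow> ('e \<Rightarrow> 'v multiset) \<Rightarrow> bool" where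
  "snark V E ends \<longleftrightarrow> multigraph V E ends \<and> two_connected V E ends \<and> cubic V E ends \<and>
     \<not> three_edge_colourable V E ends"

definition pentagon :: "'e set \<Rightarrow> ('e \<Rightarrow> 'v multiset) \<Rightarrow> 'e set \<Rightarrow> bool" where
  "pentagon E ends D \<longleftrightarrow> D \<subseteq> E \<and>
     (\<exists>vs :: nat \<Rightarrow> 'v. \<exists>es :: nat \<Rightarrow> 'e. inj_on vs {0..<5} \<and> inj_on es {0..<5} \<and>
        D = es ` {0..<5} \<and> (\<forall>i<5. ends (es i) = {#vs i, vs ((i + 1) mod 5)#}))"

definition del_edges :: "'e set \<Rightarrow> ('e \<Rightarrow> 'v multiset) \<Rightarrow> 'v set \<Rightarrow> 'e set" where
  "del_edges E ends X = {e\<in>E. set_mset (ends e) \<inter> X = {}}"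

definition heavy_pentagon :: "'v set \<Rightarrow> 'e set \<Rightarrow> ('e \<Rightarrow> 'v multiset) \<Rightarrow> 'e set \<Rightarrow> bool" where
  "heavy_pentagon V E ends D \<longleftrightarrow> pentagon E ends D \<and>
     (\<exists>e\<in>D. \<exists>u v. ends e = {#u, v#} \<and>
        three_edge_colourable (V - {u, v}) (del_edges E ends {u, v}) ends)"

definition is_cycle :: "'v set \<Rightarrow> 'e set \<Rightarrow> ('e \<Rightarrow> 'v multiset) \<Rightarrow> 'e set \<Rightarrow> bool" where
  "is_cycle V E ends C \<longleftrightarrow> C \<subseteq> E \<and> (\<forall>v\<in>V. even (deg_in C ends v))"

definition cycle_cover :: "'v set \<Rightarrow> 'e set \<Rightarrow> ('e \<Rightarrow> 'v multiset) \<Rightarrow> 'e set list \<Rightarrow> bool" where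
  "cycle_cover V E ends Cs \<longleftrightarrow> (\<forall>C\<in>set Cs. is_cycle V E ends C) \<and> \<Union>(set Cs) = E"

definition cover_length :: "'e set list \<Rightarrow> nat" where
  "cover_length Cs = sum_list (map card Cs)"

definition scc :: "'v set \<Rightarrow> 'e set \<Rightarrow> ('e \<Rightarrow> 'v multiset) \<Rightarrow> nat" where
  "scc V E ends = (LEAST l. \<exists>Cs. cycle_cover V E ends Cs \<and> cover_length Cs = l)"

end

theory Submission
  imports Defs
begin

text \<open>Heaviness yields a colouring of the edges outside the pentagon \<open>D\<close> in which every vertex off
  \<open>D\<close> sees all three colours. By parity the five edges leaving \<open>D\<close> have colours of type 3+1+1, and
  if the three equal ones are consecutive around \<open>D\<close> the whole graph is colourable. So \<open>D = wxyuv\<close>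
  carries the pattern \<open>a b a a c\<close>, and a Kempe change shows that the \<open>ac\<close>-chain \<open>R\<close> starting at \<open>w\<close>
  ends at \<open>y\<close>. Let \<open>R'\<close> be the other \<open>ac\<close>-edges and \<open>S\<close> all \<open>bc\<close>-edges; these cover the \<open>c\<close>-edges
  twice and the other edges once. Exchanging \<open>R\<close> and \<open>S\<close> along a join \<open>K\<close> from \<open>w\<close> inside the
  symmetric difference of \<open>R\<close> and \<open>S\<close> does not change these multiplicities, and for each of the three
  possible ends \<open>x\<close>, \<open>y\<close>, \<open>v\<close> of \<open>K\<close> the pieces close up through \<open>D\<close> to cycles that cover \<open>wx\<close>, \<open>yu\<close>
  once and \<open>xy\<close>, \<open>uv\<close>, \<open>vw\<close> twice. Every vertex then has total multiplicity 4, except \<open>v\<close> with 6,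
  so the length is \<open>2 |V| + 1\<close>.\<close>

section \<open>Degrees and parity\<close>

lemma deg_in_empty [simp]: "deg_in {} ends z = 0"
  by (simp add: deg_in_def)

lemma deg_in_insert:
  "finite F \<Longrightarrow> e \<notin> F \<Longrightarrow> deg_in (insert e F) ends z = count (ends e) z + deg_in F ends z"
  by (simp add: deg_in_def)

lemma deg_in_Un_disjoint:
  "finite A \<Longrightarrow> finite B \<Longrightarrow> A \<inter> B = {} \<Longrightarrow>
   deg_in (A \<union> B) ends z = deg_in A ends z + deg_in B ends z"
  by (simp add: deg_in_def sum.union_disjoint)

lemma deg_in_mono: "finite B \<Longrightarrow> A \<subseteq> B \<Longrightarrow> deg_in A ends z \<le> deg_in B ends z"
  by (simp add: deg_in_def sum_mono2)

lemma deg_in_split: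
  assumes "finite A"
  shows "deg_in A ends z = deg_in (A \<inter> B) ends z + deg_in (A - B) ends z"
  using deg_in_Un_disjoint[of "A \<inter> B" "A - B" ends z] assms by (simp add: Int_Diff_Un Int_Diff_disjoint)

lemma deg_in_colours:
  assumes "finite F" and "\<forall>e\<in>F. c e < (3::nat)"
  shows "deg_in F ends z = deg_in {e\<in>F. c e = 0} ends z + deg_in {e\<in>F. c e = 1} ends z
           + deg_in {e\<in>F. c e = 2} ends z"
proof -
  have "deg_in F ends z = deg_in ({e\<in>F. c e = 0} \<union> ({e\<in>F. c e = 1} \<union> {e\<in>F. c e = 2})) ends z"
    by (rule arg_cong[where f = "\<lambda>A. deg_in A ends z"]) (use assms(2) in force)
  also have "\<dots> = deg_in {e\<in>F. c e = 0} ends z + (deg_in {e\<in>F. c e = 1} ends z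
           + deg_in {e\<in>F. c e = 2} ends z)"
    using assms(1) by (subst deg_in_Un_disjoint, auto)+
  finally show ?thesis by simp
qed

text \<open>Edges common to both sets count twice in the sum of the two degrees, so they drop out of
  the parity. The exchange along \<open>K\<close> rests on this.\<close>

lemma odd_deg_sym_diff:
  assumes "finite A" "finite B"
  shows "odd (deg_in (sym_diff A B) ends z) \<longleftrightarrow> odd (deg_in A ends z) \<noteq> odd (deg_in B ends z)"
proof -
  have "deg_in (sym_diff A B) ends z = deg_in (A - B) ends z + deg_in (B - A) ends z"
    using assms by (intro deg_in_Un_disjoint) auto
  moreover have "deg_in A ends z = deg_in (A \<inter> B) ends z + deg_in (A - B) ends z"
    using assms by (intro deg_in_split)
  moreover have "deg_in B ends z = deg_in (A \<inter> B) ends z + deg_in (B - A) ends z"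
    using deg_in_split[of B ends z A] assms by (simp add: Int_commute)
  ultimately show ?thesis by presburger
qed

lemma handshake:
  assumes "multigraph V E ends" and "F \<subseteq> E"
  shows "(\<Sum>z\<in>V. deg_in F ends z) = 2 * card F"
proof -
  have "(\<Sum>z\<in>V. count (ends e) z) = 2" if "e \<in> F" for e
  proof -
    have e: "size (ends e) = 2" "set_mset (ends e) \<subseteq> V" and "finite V"
      using assms that by (auto simp: multigraph_def)
    have "(\<Sum>z\<in>V. count (ends e) z) = (\<Sum>z\<in>set_mset (ends e). count (ends e) z)"
      using \<open>finite V\<close> e(2) by (intro sum.mono_neutral_right) (auto simp: not_in_iff)
    then show ?thesis using e(1) by (simp add: size_multiset_overloaded_eq)
  qed
  then have "(\<Sum>e\<in>F. \<Sum>z\<in>V. count (ends e) z) = 2 * card F" by simp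
  then show ?thesis unfolding deg_in_def by (subst sum.swap)
qed

lemma odd_deg_Un_disjoint:
  assumes "finite A" "finite B" "A \<inter> B = {}"
  shows "odd (deg_in (A \<union> B) ends z) \<longleftrightarrow> odd (deg_in A ends z) \<noteq> odd (deg_in B ends z)"
  using deg_in_Un_disjoint[OF assms, of ends z] by simp

lemma deg_in_outside:
  assumes "multigraph V E ends" "F \<subseteq> E" "z \<notin> V"
  shows "deg_in F ends z = 0"
proof -
  have "count (ends e) z = 0" if "e \<in> F" for e
    using assms that unfolding multigraph_def count_eq_zero_iff by blast
  then show ?thesis by (simp add: deg_in_def)
qed

lemma size_two_msetE:
  assumes "size M = 2"
  obtains p q where "M = {#p, q#}"
proof -
  obtain p M' where p: "M = add_mset p M'"
    using assms size_eq_Suc_imp_eq_union[of M 1] by auto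
  then have "size M' = 1" using assms by simp
  then obtain q where "M' = {#q#}" using size_1_singleton_mset by blast
  then show ?thesis using that p by blast
qed

text \<open>This replaces following a path to the other end of its component. Walk from
  \<open>w\<close>, deleting each edge used, until a vertex that is odd in \<open>H\<close> is met;
  induction on \<open>card H\<close> gives termination. No claim is made that \<open>K\<close> is a
  path: only its parities are used later.\<close>

lemma odd_join_exists:
  assumes "finite H" and "\<forall>e\<in>H. size (ends e) = 2" and "odd (deg_in H ends w)"
  shows "\<exists>t K. K \<subseteq> H \<and> t \<noteq> w \<and> odd (deg_in H ends t) \<and>
           (\<forall>z. odd (deg_in K ends z) \<longleftrightarrow> z = w \<or> z = t)"
  using assms
proof (induction "card H" arbitrary: H w rule: less_induct)
  case less
  \<comment> \<open>A loop at \<open>w\<close> has count 2, so an odd count yields an edge to a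
    different vertex \<open>s\<close>.\<close>
  obtain e where e: "e \<in> H" "odd (count (ends e) w)"
    using less.prems(3) unfolding deg_in_def by (meson dvd_sum)
  have "size (ends e) = 2" using less.prems(2) e(1) by blast
  then obtain p q where pq: "ends e = {#p, q#}" by (rule size_two_msetE)
  obtain s where s: "ends e = {#w, s#}" "s \<noteq> w"
  proof (cases "p = w")
    case True
    then show ?thesis using that[of q] pq e(2) by (cases "q = w") auto
  next
    case False
    then have "q = w" using pq e(2) by (auto split: if_splits)
    then show ?thesis using that[of p] False pq by (simp add: add_mset_commute)
  qed
  have par: "odd (count (ends e) z) \<longleftrightarrow> z = w \<or> z = s" for z
    using s by auto
  have HH: "deg_in H ends z = count (ends e) z + deg_in (H - {e}) ends z" for z
    using deg_in_insert[of "H - {e}" e ends z] less.prems(1) e(1) by (simp add: insert_absorb)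
  show ?case
  proof (cases "odd (deg_in H ends s)")
    case True
    have "\<forall>z. odd (deg_in {e} ends z) \<longleftrightarrow> z = w \<or> z = s"
      using par by (simp add: deg_in_def)
    then show ?thesis using True s(2) e(1) by (intro exI[of _ s] exI[of _ "{e}"]) auto
  next
    \<comment> \<open>Removing \<open>e\<close> makes \<open>s\<close> odd and \<open>w\<close>
      even. The walk therefore continues from \<open>s\<close> and cannot end at
      \<open>w\<close>.\<close>
    case False
    have "card (H - {e}) < card H" using less.prems(1) e(1) by (meson card_Diff1_less)
    moreover have "odd (deg_in (H - {e}) ends s)" using False HH[of s] par[of s] by simp
    ultimately obtain t K where tK: "K \<subseteq> H - {e}" "t \<noteq> s" "odd (deg_in (H - {e}) ends t)"
        "\<forall>z. odd (deg_in K ends z) \<longleftrightarrow> z = s \<or> z = t"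
      using less.hyps[of "H - {e}" s] less.prems by auto
    have "t \<noteq> w" using tK(3) HH[of w] par[of w] less.prems(3) by auto
    moreover have "odd (deg_in H ends t)" using tK(2,3) HH[of t] par[of t] calculation by simp
    moreover have "odd (deg_in (insert e K) ends z) \<longleftrightarrow> z = w \<or> z = t" for z
    proof -
      have "finite K" using tK(1) less.prems(1) by (meson finite_Diff finite_subset)
      then have "deg_in (insert e K) ends z = count (ends e) z + deg_in K ends z"
        using tK(1) by (intro deg_in_insert) auto
      then show ?thesis using par[of z] tK(2,4) s(2) \<open>t \<noteq> w\<close> by auto
    qed
    ultimately show ?thesis using tK(1) e(1) by (intro exI[of _ t] exI[of _ "insert e K"]) auto
  qed
qed

text \<open>Colour the missing edges greedily, one at a time. Each has an end in \<open>X\<close>,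
  where nothing is required, so at most its other end restricts the choice.\<close>

lemma extend_colouring:
  assumes "multigraph V E ends" "cubic V E ends"
    and "three_edge_colourable (V - X) (del_edges E ends X) ends"
  shows "\<exists>c :: 'e \<Rightarrow> nat. (\<forall>e\<in>E. c e < 3) \<and>
           (\<forall>z\<in>V - X. \<forall>k. deg_in {e\<in>E. c e = k} ends z \<le> 1)"
proof -
  let ?N = "del_edges E ends X"
  have finE: "finite E" using assms(1) by (simp add: multigraph_def)
  have "\<exists>c :: 'e \<Rightarrow> nat. (\<forall>e\<in>?N \<union> S. c e < 3) \<and>
           (\<forall>z\<in>V - X. \<forall>k. deg_in {e\<in>?N \<union> S. c e = k} ends z \<le> 1)"
    if "finite S" "S \<subseteq> E - ?N" for S
    using that
  proof (induction S rule: finite_induct)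
    case empty
    then show ?case using assms(3) by (simp add: three_edge_colourable_def)
  next
    case (insert f S)
    let ?F = "?N \<union> S"
    obtain c :: "'e \<Rightarrow> nat" where c: "\<forall>e\<in>?F. c e < 3"
        "\<forall>z\<in>V - X. \<forall>k. deg_in {e\<in>?F. c e = k} ends z \<le> 1"
      using insert by auto
    have f: "f \<in> E" "f \<notin> ?F" using insert by auto
    have finF: "finite ?F" and FE: "insert f ?F \<subseteq> E"
      using finE insert by (auto simp: del_edges_def intro: finite_subset)
    have "size (ends f) = 2" using assms(1) f(1) by (simp add: multigraph_def)
    then obtain p' q' where p'q': "ends f = {#p', q'#}" by (rule size_two_msetE)
    moreover have "p' \<in> X \<or> q' \<in> X"
      using p'q' f(1) insert.prems by (auto simp: del_edges_def)
    ultimately obtain p q where pq: "p \<in> X" "ends f = {#p, q#}"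
      by (metis add_mset_commute)
    \<comment> \<open>If \<open>q\<close> is outside \<open>X\<close>, its degree 3 leaves room for
      at most two coloured edges besides \<open>f\<close>, so some colour is free.\<close>
    have "\<exists>k<3. q \<in> V - X \<longrightarrow> deg_in {e\<in>?F. c e = k} ends q = 0"
    proof (rule ccontr)
      assume "\<not> ?thesis"
      then have q: "q \<in> V - X" and pos: "\<And>k. k < 3 \<Longrightarrow> deg_in {e\<in>?F. c e = k} ends q > 0"
        by (metis not_gr_zero zero_less_numeral)+
      have "deg_in ?F ends q \<ge> 3"
        using deg_in_colours[OF finF c(1), of ends q] pos[of 0] pos[of 1] pos[of 2] by simp
      moreover have "deg_in (insert f ?F) ends q \<ge> 1 + deg_in ?F ends q"
        using deg_in_insert[OF finF f(2), of ends q] pq by simp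
      moreover have "deg_in (insert f ?F) ends q \<le> 3"
        using deg_in_mono[OF finE FE, of ends q] assms(2) q by (simp add: cubic_def)
      ultimately show False by simp
    qed
    then obtain k where k: "k < 3" "q \<in> V - X \<longrightarrow> deg_in {e\<in>?F. c e = k} ends q = 0" by blast
    have "deg_in {e\<in>?N \<union> insert f S. (c(f := k)) e = j} ends z \<le> 1" if z: "z \<in> V - X" for z j
    proof (cases "j = k")
      case True
      have "{e\<in>?N \<union> insert f S. (c(f := k)) e = j} = insert f {e\<in>?F. c e = k}"
        using f(2) True by auto
      moreover have "deg_in (insert f {e\<in>?F. c e = k}) ends z
          = count (ends f) z + deg_in {e\<in>?F. c e = k} ends z"
        using finF f(2) by (intro deg_in_insert) auto
      moreover have "deg_in {e\<in>?F. c e = k} ends z \<le> 1" using c(2) z by blast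
      ultimately show ?thesis using pq z k(2) by auto
    next
      case False
      then have "{e\<in>?N \<union> insert f S. (c(f := k)) e = j} = {e\<in>?F. c e = j}"
        using f(2) by auto
      then show ?thesis using c(2) z by simp
    qed
    moreover have "\<forall>e\<in>?N \<union> insert f S. (c(f := k)) e < 3" using c(1) k(1) by auto
    ultimately show ?case by blast
  qed
  from this[of "E - ?N"] show ?thesis
    using finE by (simp add: del_edges_def Un_absorb1 subset_eq)
qed

section \<open>Colourings of the complement of a pentagon\<close>

text \<open>Lists are used so that \<open>rotate1\<close> moves the base point. Each argument can
  then be given for one position on the pentagon and transferred to the others.\<close>

definition five_circuit :: "'v set \<Rightarrow> 'e set \<Rightarrow> ('e \<Rightarrow> 'v multiset) \<Rightarrow> 'v list \<Rightarrow> 'e list \<Rightarrow> bool" where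
  "five_circuit V E ends vs es \<longleftrightarrow> length vs = 5 \<and> length es = 5 \<and> distinct vs \<and> distinct es \<and>
     set vs \<subseteq> V \<and> set es \<subseteq> E \<and> map ends es = map2 (\<lambda>p q. {#p, q#}) vs (rotate1 vs)"

lemma five_circuit_rotate:
  assumes "five_circuit V E ends vs es"
  shows "five_circuit V E ends (rotate1 vs) (rotate1 es)"
  using assms by (auto simp: five_circuit_def length_Suc_conv eval_nat_numeral)

text \<open>The edges outside the pentagon are coloured so that every vertex off the pentagon sees each
  colour exactly once, and \<open>t z\<close> is the colour of the unique such edge at a pentagon vertex \<open>z\<close>.\<close>

definition pole_colouring ::
  "'v set \<Rightarrow> 'e set \<Rightarrow> ('e \<Rightarrow> 'v multiset) \<Rightarrow> 'v set \<Rightarrow> 'e set \<Rightarrow> ('e \<Rightarrow> nat) \<Rightarrow> ('v \<Rightarrow> nat) \<Rightarrow> bool" where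
  "pole_colouring V E ends X D c t \<longleftrightarrow> (\<forall>e\<in>E - D. c e < 3) \<and> (\<forall>z\<in>X. t z < 3) \<and>
     (\<forall>z\<in>V. \<forall>k<3. deg_in {e\<in>E - D. c e = k} ends z =
        (if z \<in> X then if t z = k then 1 else 0 else 1))"

text \<open>Swap \<open>k\<close> and \<open>l\<close> on \<open>R\<close>. Off \<open>X\<close>
  each vertex has one edge of each colour, and even \<open>R\<close>-degree means that both or
  neither are swapped. At \<open>p\<close> and \<open>q\<close> the single edge is swapped, and
  \<open>k + l - t z\<close> is its new colour.\<close>

lemma pole_colouring_kempe:
  assumes fin: "finite E" and pole: "pole_colouring V E ends X D c t"
    and kl: "k < 3" "l < 3" "k \<noteq> l" and R: "R \<subseteq> {e\<in>E - D. c e = k \<or> c e = l}"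
    and odd: "\<forall>z. odd (deg_in R ends z) \<longleftrightarrow> z = p \<or> z = q"
    and pq: "p \<in> X" "q \<in> X" "t p = k \<or> t p = l" "t q = k \<or> t q = l"
  shows "\<exists>c'. pole_colouring V E ends X D c' (\<lambda>z. if z = p \<or> z = q then k + l - t z else t z)"
proof -
  define c' where "c' e = (if e \<in> R then k + l - c e else c e)" for e
  let ?C = "\<lambda>j. {e\<in>E - D. c e = j}" and ?C' = "\<lambda>j. {e\<in>E - D. c' e = j}"
  let ?t = "\<lambda>z. if z = p \<or> z = q then k + l - t z else t z"
  have finC: "finite (?C j)" for j using fin by simp
  have dC: "deg_in (?C j) ends z = (if z \<in> X then if t z = j then 1 else 0 else 1)"
    if "z \<in> V" "j < 3" for j z
    using pole that by (simp add: pole_colouring_def)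
  have "deg_in (?C' j) ends z = (if z \<in> X then if ?t z = j then 1 else 0 else 1)"
    if z: "z \<in> V" and j: "j < 3" for z j
  proof -
    have sk: "deg_in (?C k) ends z = deg_in (?C k \<inter> R) ends z + deg_in (?C k - R) ends z"
      and sl: "deg_in (?C l) ends z = deg_in (?C l \<inter> R) ends z + deg_in (?C l - R) ends z"
      using finC by (auto intro: deg_in_split)
    have "R = (?C k \<inter> R) \<union> (?C l \<inter> R)" using R by auto
    then have "deg_in R ends z = deg_in ((?C k \<inter> R) \<union> (?C l \<inter> R)) ends z" by simp
    also have "\<dots> = deg_in (?C k \<inter> R) ends z + deg_in (?C l \<inter> R) ends z"
      using finC kl by (intro deg_in_Un_disjoint) auto
    finally have sR: "deg_in R ends z = deg_in (?C k \<inter> R) ends z + deg_in (?C l \<inter> R) ends z" .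
    have "?C' k = (?C k - R) \<union> (?C l \<inter> R)" using R kl by (auto simp: c'_def)
    then have "deg_in (?C' k) ends z = deg_in ((?C k - R) \<union> (?C l \<inter> R)) ends z" by simp
    also have "\<dots> = deg_in (?C k - R) ends z + deg_in (?C l \<inter> R) ends z"
      using finC by (intro deg_in_Un_disjoint) auto
    finally have dk: "deg_in (?C' k) ends z = deg_in (?C k - R) ends z + deg_in (?C l \<inter> R) ends z" .
    have "?C' l = (?C l - R) \<union> (?C k \<inter> R)" using R kl by (auto simp: c'_def)
    then have "deg_in (?C' l) ends z = deg_in ((?C l - R) \<union> (?C k \<inter> R)) ends z" by simp
    also have "\<dots> = deg_in (?C l - R) ends z + deg_in (?C k \<inter> R) ends z"
      using finC by (intro deg_in_Un_disjoint) auto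
    finally have dl: "deg_in (?C' l) ends z = deg_in (?C l - R) ends z + deg_in (?C k \<inter> R) ends z" .
    have other: "?C' j = ?C j" if "j \<noteq> k" "j \<noteq> l"
      using R that by (auto simp: c'_def)
    \<comment> \<open>Unprimed numbers count edges inside \<open>R\<close>, primed ones edges
      outside. The swap turns the degrees \<open>r + r'\<close> and \<open>s + s'\<close> into
      \<open>r' + s\<close> and \<open>s' + r\<close>, which leaves small arithmetic.\<close>
    define r r' s s' where rs: "r = deg_in (?C k \<inter> R) ends z" "r' = deg_in (?C k - R) ends z"
      "s = deg_in (?C l \<inter> R) ends z" "s' = deg_in (?C l - R) ends z"
    have rs_sum: "r + r' = (if z \<in> X then if t z = k then 1 else 0 else 1)"
        "s + s' = (if z \<in> X then if t z = l then 1 else 0 else 1)"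
      using sk sl dC[OF z kl(1)] dC[OF z kl(2)] by (simp_all add: rs)
    have rs_odd: "odd (r + s) \<longleftrightarrow> z = p \<or> z = q"
      using odd[rule_format, of z] unfolding sR rs .
    have C'kl: "deg_in (?C' k) ends z = r' + s" "deg_in (?C' l) ends z = s' + r"
      using dk dl by (simp_all add: rs)
    consider "z \<notin> X" | "z \<in> X" "z \<noteq> p" "z \<noteq> q" | "z = p \<or> z = q" by blast
    then show ?thesis
    proof cases
      case 1
      then have "r + r' = 1" "s + s' = 1" "even (r + s)"
        using rs_sum rs_odd pq(1,2) by auto
      then have "r' + s = 1" "s' + r = 1" by presburger+
      then show ?thesis using 1 C'kl other dC[OF z j] by (cases "j = k"; cases "j = l") auto
    next
      case 2
      have "r + r' + (s + s') \<le> 1" using rs_sum kl(3) 2 by auto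
      moreover have "even (r + s)" using 2 rs_odd by blast
      ultimately have "r = 0" "s = 0" by presburger+
      then show ?thesis using 2 C'kl other dC[OF z j] rs_sum
        by (cases "j = k"; cases "j = l") auto
    next
      case 3
      then have zX: "z \<in> X" "t z = k \<or> t z = l" using pq by auto
      have "r + r' + (s + s') \<le> 1" using rs_sum kl(3) zX by auto
      moreover have "odd (r + s)" using 3 rs_odd by blast
      ultimately have "r' = 0" "s' = 0" by presburger+
      then show ?thesis using 3 zX C'kl other dC[OF z j] rs_sum kl
        by (cases "j = k"; cases "j = l") auto
    qed
  qed
  moreover have "\<forall>e\<in>E - D. c' e < 3" "\<forall>z\<in>X. ?t z < 3"
    using pole R kl pq by (auto simp: c'_def pole_colouring_def)
  ultimately show ?thesis unfolding pole_colouring_def by blast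
qed

section \<open>Degrees on the pentagon, and colouring its edges\<close>

lemma five_circuit_degree:
  assumes "five_circuit V E ends vs es"
  shows "deg_in (set es) ends z = (if z \<in> set vs then 2 else 0)"
proof -
  obtain w x y u v where vs: "vs = [w, x, y, u, v]"
    using assms by (auto simp: five_circuit_def length_Suc_conv eval_nat_numeral)
  obtain wx xy yu uv vw where es: "es = [wx, xy, yu, uv, vw]"
    using assms by (auto simp: five_circuit_def length_Suc_conv eval_nat_numeral)
  have ends: "ends wx = {#w, x#}" "ends xy = {#x, y#}" "ends yu = {#y, u#}" "ends uv = {#u, v#}"
      "ends vw = {#v, w#}" and dist: "distinct vs" "distinct es"
    using assms by (auto simp: five_circuit_def vs es)
  have "deg_in (set es) ends z = count (ends wx) z + count (ends xy) z + count (ends yu) z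
      + count (ends uv) z + count (ends vw) z"
    using dist(2) by (simp add: es deg_in_def)
  then show ?thesis using dist(1) by (simp add: ends vs) auto
qed

text \<open>An explicit colouring of the pentagon. In a snark it excludes three consecutive equal
  colours, also after any Kempe change.\<close>

lemma consecutive_imp_colourable:
  assumes fin: "finite E"
    and circ: "five_circuit V E ends [w, x, y, u, v] [wx, xy, yu, uv, vw]"
    and pole: "pole_colouring V E ends {w, x, y, u, v} {wx, xy, yu, uv, vw} c t"
    and t: "t x = t w" "t y = t w" "t u \<noteq> t w" "t v \<noteq> t w" "t u \<noteq> t v"
  shows "three_edge_colourable V E ends"
proof -
  let ?D = "{wx, xy, yu, uv, vw}"
  \<comment> \<open>Along the path \<open>v w x y u\<close> the colours \<open>t u\<close> and
    \<open>t v\<close> alternate, starting with \<open>t u\<close> since \<open>v\<close> already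
    sees \<open>t v\<close>. The closing edge \<open>uv\<close> receives \<open>t w\<close>.\<close>
  define c' where
    "c' = c(uv := t w, yu := t v, xy := t u, wx := t v, vw := t u)"
  have D: "distinct [w, x, y, u, v]" "distinct [wx, xy, yu, uv, vw]" "?D \<subseteq> E"
      "ends wx = {#w, x#}" "ends xy = {#x, y#}" "ends yu = {#y, u#}" "ends uv = {#u, v#}"
      "ends vw = {#v, w#}"
    using circ by (auto simp: five_circuit_def)
  have lt: "t w < 3" "t u < 3" "t v < 3" using pole by (auto simp: pole_colouring_def)
  have c'_out: "c' e = c e" if "e \<notin> ?D" for e using that by (simp add: c'_def)
  have c'_D: "c' uv = t w" "c' yu = t v" "c' xy = t u" "c' wx = t v" "c' vw = t u"
    using D(2) by (auto simp: c'_def)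
  have split: "deg_in {e\<in>E. c' e = k} ends z
      = deg_in {e\<in>E - ?D. c e = k} ends z + deg_in {e\<in>?D. c' e = k} ends z" for k z
  proof -
    have "{e\<in>E. c' e = k} = {e\<in>E - S. c e = k} \<union> {e\<in>S. c' e = k}"
      if "S \<subseteq> E" "\<And>e. e \<notin> S \<Longrightarrow> c' e = c e" for S
      using that by auto
    from this[OF D(3) c'_out] have "deg_in {e\<in>E. c' e = k} ends z
        = deg_in ({e\<in>E - ?D. c e = k} \<union> {e\<in>?D. c' e = k}) ends z" by simp
    also have "\<dots> = deg_in {e\<in>E - ?D. c e = k} ends z + deg_in {e\<in>?D. c' e = k} ends z"
      using fin by (intro deg_in_Un_disjoint) auto
    finally show ?thesis .
  qed
  have lt': "\<forall>e\<in>E. c' e < 3"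
  proof
    fix e assume "e \<in> E"
    then show "c' e < 3"
      using pole lt c'_out[of e] by (cases "e \<in> ?D") (auto simp: c'_D pole_colouring_def)
  qed
  have "deg_in {e\<in>E. c' e = k} ends z \<le> 1" if z: "z \<in> V" for z k
  proof (cases "k < 3")
    case True
    then have k: "k = t w \<or> k = t u \<or> k = t v" using lt t by linarith
    have sets: "{e\<in>?D. c' e = t w} = {uv}" "{e\<in>?D. c' e = t u} = {xy, vw}"
        "{e\<in>?D. c' e = t v} = {wx, yu}"
      using t by (auto simp: c'_D)
    have degs: "deg_in {uv} ends z = count {#u, v#} z"
        "deg_in {xy, vw} ends z = count {#x, y#} z + count {#v, w#} z"
        "deg_in {wx, yu} ends z = count {#w, x#} z + count {#y, u#} z"
      using D(2) by (simp_all add: deg_in_def D(4-8) del: count_add_mset)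
    have out: "deg_in {e\<in>E - ?D. c e = k} ends z
        = (if z \<in> {w, x, y, u, v} then if t z = k then 1 else 0 else 1)"
      using pole z True by (simp add: pole_colouring_def)
    show ?thesis
      unfolding split out using k
    proof (elim disjE)
      assume "k = t w"
      then show "(if z \<in> {w, x, y, u, v} then if t z = k then 1 else 0 else 1)
          + deg_in {e\<in>?D. c' e = k} ends z \<le> 1"
        using t D(1) by (simp only: sets degs) auto
    next
      assume "k = t u"
      then show "(if z \<in> {w, x, y, u, v} then if t z = k then 1 else 0 else 1)
          + deg_in {e\<in>?D. c' e = k} ends z \<le> 1"
        using t D(1) by (simp only: sets degs) auto
    next
      assume "k = t v"
      then show "(if z \<in> {w, x, y, u, v} then if t z = k then 1 else 0 else 1)
          + deg_in {e\<in>?D. c' e = k} ends z \<le> 1"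
        using t D(1) by (simp only: sets degs) auto
    qed
  next
    case False
    then have "{e\<in>E. c' e = k} = {}" using lt' by auto
    then show ?thesis by (simp only: deg_in_empty)
  qed
  then show ?thesis using lt' unfolding three_edge_colourable_def by blast
qed

text \<open>As \<open>p\<close> and \<open>q\<close> lie on the pentagon, the extended colouring is
  proper at every vertex off it, and degree 3 forces each colour exactly once there. A pentagon
  vertex keeps one outside edge, whose colour defines \<open>t\<close>.\<close>

lemma pole_colouring_exists:
  assumes mg: "multigraph V E ends" and cub: "cubic V E ends"
    and circ: "five_circuit V E ends vs es" and pq: "p \<in> set vs" "q \<in> set vs"
    and col: "three_edge_colourable (V - {p, q}) (del_edges E ends {p, q}) ends"
  shows "\<exists>c t. pole_colouring V E ends (set vs) (set es) c t"
proof -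
  let ?N = "E - set es"
  obtain c :: "'b \<Rightarrow> nat" where c: "\<forall>e\<in>E. c e < 3"
      "\<forall>z\<in>V - {p, q}. \<forall>k. deg_in {e\<in>E. c e = k} ends z \<le> 1"
    using extend_colouring[OF mg cub col] by blast
  have fin: "finite E" using mg by (simp add: multigraph_def)
  have esE: "set es \<subseteq> E" using circ by (simp add: five_circuit_def)
  have degN: "deg_in ?N ends z = (if z \<in> set vs then 1 else 3)" if "z \<in> V" for z
    using deg_in_split[OF fin, of ends z "set es"] esE cub that five_circuit_degree[OF circ, of z]
    by (auto simp: cubic_def Int_absorb1)
  have sum: "deg_in ?N ends z = deg_in {e\<in>?N. c e = 0} ends z + deg_in {e\<in>?N. c e = 1} ends z
      + deg_in {e\<in>?N. c e = 2} ends z" for z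
    using fin c(1) by (intro deg_in_colours) auto
  have less3: "k = 0 \<or> k = 1 \<or> k = 2" if "k < 3" for k :: nat
    using that by linarith
  have off: "deg_in {e\<in>?N. c e = k} ends z = 1" if z: "z \<in> V" "z \<notin> set vs" and k: "k < 3" for z k
  proof -
    have le: "deg_in {e\<in>?N. c e = j} ends z \<le> 1" for j
    proof -
      have "deg_in {e\<in>?N. c e = j} ends z \<le> deg_in {e\<in>E. c e = j} ends z"
        using fin by (intro deg_in_mono) auto
      also have "\<dots> \<le> 1" using c(2) z pq by blast
      finally show ?thesis .
    qed
    show ?thesis using le[of 0] le[of 1] le[of 2] sum[of z] degN[OF z(1)] z(2) less3[OF k]
      by (elim disjE) simp_all
  qed
  have "\<exists>j<3. \<forall>k<3. deg_in {e\<in>?N. c e = k} ends z = (if j = k then 1 else 0)"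
    if z: "z \<in> set vs" for z
  proof -
    have "z \<in> V" using z circ by (auto simp: five_circuit_def)
    then have one: "deg_in {e\<in>?N. c e = 0} ends z + deg_in {e\<in>?N. c e = 1} ends z
      + deg_in {e\<in>?N. c e = 2} ends z = 1" using sum[of z] degN[of z] z by simp
    define d where "d k = deg_in {e\<in>?N. c e = k} ends z" for k
    have "d 0 + d 1 + d 2 = 1" using one by (simp add: d_def)
    then consider "d 0 = 1" "d 1 = 0" "d 2 = 0" | "d 0 = 0" "d 1 = 1" "d 2 = 0"
      | "d 0 = 0" "d 1 = 0" "d 2 = 1" by linarith
    then have "\<exists>j<3. \<forall>k<3. d k = (if j = k then 1 else 0)"
    proof cases
      case 1
      then show ?thesis using less3 by (intro exI[of _ 0]) fastforce
    next
      case 2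
      then show ?thesis using less3 by (intro exI[of _ 1]) fastforce
    next
      case 3
      then show ?thesis using less3 by (intro exI[of _ 2]) fastforce
    qed
    then show ?thesis by (simp add: d_def)
  qed
  then obtain t where t: "\<forall>z\<in>set vs. t z < 3 \<and>
      (\<forall>k<3. deg_in {e\<in>?N. c e = k} ends z = (if t z = k then 1 else 0))"
    using bchoice[of "set vs" "\<lambda>z j. j < 3 \<and>
      (\<forall>k<3. deg_in {e\<in>?N. c e = k} ends z = (if j = k then 1 else 0))"] by blast
  have "pole_colouring V E ends (set vs) (set es) c t"
    unfolding pole_colouring_def using c(1) t off by simp
  then show ?thesis by blast
qed

text \<open>Handshake for one colour class. It serves twice: for the parity that forces the type
  3+1+1, and for the length of the cover.\<close>

lemma pole_class_card:
  assumes mg: "multigraph V E ends" and circ: "five_circuit V E ends vs es"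
    and pole: "pole_colouring V E ends (set vs) (set es) c t" and k: "k < 3"
  shows "2 * card {e\<in>E - set es. c e = k} + 5 = card V + card {z\<in>set vs. t z = k}"
proof -
  have fin: "finite V" using mg by (simp add: multigraph_def)
  have vs: "set vs \<subseteq> V" "card (set vs) = 5"
    using circ distinct_card[of vs] by (auto simp: five_circuit_def)
  have "2 * card {e\<in>E - set es. c e = k} = (\<Sum>z\<in>V. deg_in {e\<in>E - set es. c e = k} ends z)"
    using handshake[OF mg, of "{e\<in>E - set es. c e = k}"] by auto
  also have "\<dots> = (\<Sum>z\<in>V. if z \<in> set vs then if t z = k then 1 else 0 else 1)"
    using pole k by (intro sum.cong) (auto simp: pole_colouring_def)
  also have "\<dots> = (\<Sum>z\<in>V - set vs. if z \<in> set vs then if t z = k then 1 else 0 else 1)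
      + (\<Sum>z\<in>set vs. if z \<in> set vs then if t z = k then 1 else 0 else 1)"
    using vs fin by (intro sum.subset_diff) auto
  also have "(\<Sum>z\<in>V - set vs. if z \<in> set vs then if t z = k then 1 else 0 else 1)
      = (\<Sum>z\<in>V - set vs. 1)"
    by (intro sum.cong) auto
  also have "(\<Sum>z\<in>set vs. if z \<in> set vs then if t z = k then 1 else 0 else 1)
      = (\<Sum>z\<in>set vs. if t z = k then 1 else 0)"
    by (intro sum.cong) auto
  also have "\<dots> = card {z\<in>set vs. t z = k}"
    by (simp add: sum.If_cases Int_def)
  finally have "2 * card {e\<in>E - set es. c e = k} = card (V - set vs) + card {z\<in>set vs. t z = k}"
    by simp
  moreover have "card (V - set vs) + 5 = card V"
    using vs fin card_mono[of V "set vs"] by (simp add: card_Diff_subset)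
  ultimately show ?thesis by simp
qed

lemma cubic_card:
  assumes "multigraph V E ends" "cubic V E ends"
  shows "2 * card E = 3 * card V"
  using handshake[OF assms(1), of E] assms(2) by (simp add: cubic_def)

section \<open>The short cover\<close>

text \<open>Each element of \<open>K\<close> lies in exactly one of \<open>P\<close> and
  \<open>Q\<close> and merely moves to the other.\<close>

lemma card_sym_diff_exchange:
  assumes "finite P" "finite Q" "K \<subseteq> sym_diff P Q"
  shows "card (sym_diff P K) + card (sym_diff Q K) = card P + card Q"
proof -
  have fK: "finite K" using assms by (meson finite_Diff finite_Un finite_subset)
  have "card (sym_diff P K) = card (P - K) + card (K \<inter> Q)"
    using assms fK by (subst card_Un_disjoint[symmetric]) (auto intro!: arg_cong[where f = card])
  moreover have "card (sym_diff Q K) = card (Q - K) + card (K \<inter> P)"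
    using assms fK by (subst card_Un_disjoint[symmetric]) (auto intro!: arg_cong[where f = card])
  moreover have "card P = card (K \<inter> P) + card (P - K)"
    using card_Int_Diff[OF assms(1), of K] by (simp add: Int_commute)
  moreover have "card Q = card (K \<inter> Q) + card (Q - K)"
    using card_Int_Diff[OF assms(2), of K] by (simp add: Int_commute)
  ultimately show ?thesis by simp
qed

text \<open>With \<open>a = t w\<close>, \<open>b = t x\<close>, \<open>c = t v\<close>, this is the
  pattern \<open>a b a a c\<close>. Non-colourability enters only to force the end \<open>s\<close>
  of \<open>R\<close> to be \<open>y\<close>.\<close>

lemma nonconsecutive_imp_short_cover:
  assumes mg: "multigraph V E ends" and ncol: "\<not> three_edge_colourable V E ends"
    and circ: "five_circuit V E ends [w, x, y, u, v] [wx, xy, yu, uv, vw]"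
    and pole: "pole_colouring V E ends {w, x, y, u, v} {wx, xy, yu, uv, vw} c t"
    and t: "t y = t w" "t u = t w" "t x \<noteq> t w" "t v \<noteq> t w" "t x \<noteq> t v"
  shows "\<exists>Cs. cycle_cover V E ends Cs \<and> cover_length Cs = 2 * card V + 1"
proof -
  define D where "D = {wx, xy, yu, uv, vw}"
  define A B C where ABC: "A = {e\<in>E - D. c e = t w}" "B = {e\<in>E - D. c e = t x}" "C = {e\<in>E - D. c e = t v}"
  have fin: "finite E" using mg by (simp add: multigraph_def)
  have dist: "distinct [w, x, y, u, v]" "distinct [wx, xy, yu, uv, vw]"
    and ends: "ends wx = {#w, x#}" "ends xy = {#x, y#}" "ends yu = {#y, u#}" "ends uv = {#u, v#}"
      "ends vw = {#v, w#}"
    and DE: "D \<subseteq> E" and XV: "w \<in> V" "x \<in> V" "y \<in> V" "u \<in> V" "v \<in> V"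
    using circ by (auto simp: five_circuit_def D_def)
  have vdist: "w \<noteq> x" "w \<noteq> y" "w \<noteq> u" "w \<noteq> v" "x \<noteq> y" "x \<noteq> u" "x \<noteq> v" "y \<noteq> u" "y \<noteq> v" "u \<noteq> v"
    using dist(1) by auto
  have lt: "t w < 3" "t x < 3" "t v < 3" and cN: "\<And>e. e \<in> E - D \<Longrightarrow> c e < 3"
    using pole by (auto simp: pole_colouring_def D_def)
  have fABC: "finite A" "finite B" "finite C" using fin by (simp_all add: ABC)
  have disj: "A \<inter> C = {}" "B \<inter> C = {}" using t by (auto simp: ABC)
  have ABC_E: "A \<subseteq> E - D" "B \<subseteq> E - D" "C \<subseteq> E - D" by (auto simp: ABC)
  have N: "E - D = A \<union> B \<union> C"
  proof -
    have "c e = t w \<or> c e = t x \<or> c e = t v" if "e \<in> E - D" for e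
      using cN[OF that] lt t by linarith
    then show ?thesis unfolding ABC by blast
  qed
  have deg: "deg_in {e\<in>E - D. c e = k} ends z =
      (if z \<in> {w, x, y, u, v} then if t z = k then 1 else 0 else 1)" if "k < 3" "z \<in> V" for k z
    using pole that by (simp add: pole_colouring_def D_def)
  have oddAC: "odd (deg_in (A \<union> C) ends z) \<longleftrightarrow> z = w \<or> z = y \<or> z = u \<or> z = v" for z
  proof (cases "z \<in> V")
    case True
    show ?thesis
      using deg[OF lt(1) True, folded ABC] deg[OF lt(3) True, folded ABC] t vdist
      unfolding odd_deg_Un_disjoint[OF fABC(1,3) disj(1)] by auto
  next
    case False
    have "A \<union> C \<subseteq> E" using ABC_E by blast
    then show ?thesis using deg_in_outside[OF mg _ False] False XV by fastforce
  qed
  have oddBC: "odd (deg_in (B \<union> C) ends z) \<longleftrightarrow> z = x \<or> z = v" for z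
  proof (cases "z \<in> V")
    case True
    show ?thesis
      using deg[OF lt(2) True, folded ABC] deg[OF lt(3) True, folded ABC] t vdist
      unfolding odd_deg_Un_disjoint[OF fABC(2,3) disj(2)] by auto
  next
    case False
    have "B \<union> C \<subseteq> E" using ABC_E by blast
    then show ?thesis using deg_in_outside[OF mg _ False] False XV by fastforce
  qed
  have size2: "\<forall>e\<in>F. size (ends e) = 2" if "F \<subseteq> E" for F
    using mg that by (auto simp: multigraph_def)
  obtain s R where R: "R \<subseteq> A \<union> C" "s \<noteq> w" "odd (deg_in (A \<union> C) ends s)"
      "\<forall>z. odd (deg_in R ends z) \<longleftrightarrow> z = w \<or> z = s"
    using odd_join_exists[of "A \<union> C" ends w] fABC size2[of "A \<union> C"] ABC_E oddAC by blast
  have rot: "five_circuit V E ends [u, v, w, x, y] [uv, vw, wx, xy, yu]"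
      "five_circuit V E ends [y, u, v, w, x] [yu, uv, vw, wx, xy]"
    using five_circuit_rotate[OF five_circuit_rotate[OF five_circuit_rotate[OF circ]]]
      five_circuit_rotate[OF five_circuit_rotate[OF circ]] by simp_all
  have "s = y"
  proof (rule ccontr)
    assume "s \<noteq> y"
    then have s: "s = u \<or> s = v" using R(2,3) oddAC by blast
    \<comment> \<open>The outside colours after exchanging \<open>t w\<close> and \<open>t v\<close>
      along \<open>R\<close>.\<close>
    let ?t = "\<lambda>z. if z = w \<or> z = s then t w + t v - t z else t z"
    have "\<exists>c'. pole_colouring V E ends {w, x, y, u, v} D c' ?t"
      using fin pole lt t R(1,4) s
      by (intro pole_colouring_kempe[where R = R and c = c]) (auto simp: ABC D_def)
    then obtain c' where c': "pole_colouring V E ends {w, x, y, u, v} D c' ?t" by blast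
    show False
      using s
    proof
      \<comment> \<open>Now \<open>u\<close>, \<open>v\<close>, \<open>w\<close> are consecutive and
        all have the colour \<open>t v\<close>.\<close>
      assume "s = u"
      have "pole_colouring V E ends {u, v, w, x, y} {uv, vw, wx, xy, yu} c' ?t"
        using c' by (simp add: D_def insert_commute)
      from consecutive_imp_colourable[OF fin rot(1) this] show False
        using ncol t vdist \<open>s = u\<close> by simp
    next
      \<comment> \<open>Now \<open>y\<close>, \<open>u\<close>, \<open>v\<close> are consecutive and
        all have the colour \<open>t w\<close>.\<close>
      assume "s = v"
      have "pole_colouring V E ends {y, u, v, w, x} {yu, uv, vw, wx, xy} c' ?t"
        using c' by (simp add: D_def insert_commute)
      from consecutive_imp_colourable[OF fin rot(2) this] show False
        using ncol t vdist \<open>s = v\<close> by simp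
    qed
  qed
  then have oddR: "odd (deg_in R ends z) \<longleftrightarrow> z = w \<or> z = y" for z using R(4) by simp
  define R' where "R' = A \<union> C - R"
  have fR: "finite R" "finite R'" using R(1) fABC by (auto simp: R'_def intro: finite_subset)
  have oddR': "odd (deg_in R' ends z) \<longleftrightarrow> z = u \<or> z = v" for z
  proof -
    have "deg_in (A \<union> C) ends z = deg_in R ends z + deg_in R' ends z"
      using deg_in_split[of "A \<union> C" ends z R] fABC R(1) by (simp add: R'_def Int_absorb1)
    then show ?thesis using oddAC[of z] oddR[of z] vdist by (auto simp: even_add)
  qed
  let ?H = "sym_diff R (B \<union> C)"
  have oddH: "odd (deg_in ?H ends z) \<longleftrightarrow> z = w \<or> z = y \<or> z = x \<or> z = v" for z
    using odd_deg_sym_diff[of R "B \<union> C" ends z] fR fABC oddR[of z] oddBC[of z] vdist by auto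
  have HE: "?H \<subseteq> E - D" using R(1) ABC_E by blast
  obtain r K where K: "K \<subseteq> ?H" "r \<noteq> w" "odd (deg_in ?H ends r)"
      "\<forall>z. odd (deg_in K ends z) \<longleftrightarrow> z = w \<or> z = r"
    using odd_join_exists[of ?H ends w] fR fABC size2[of ?H] HE oddH by blast
  have fK: "finite K" using K(1) fR fABC by (meson finite_Diff finite_Un finite_subset)
  \<comment> \<open>Edges of \<open>K\<close> change sides, so the union and the total size are
    kept, while the odd vertices of both sets change by \<open>w\<close> and
    \<open>r\<close>.\<close>
  define P Q where PQ: "P = sym_diff R K" "Q = sym_diff (B \<union> C) K"
  have oddP: "odd (deg_in P ends z) \<longleftrightarrow> (z = w \<or> z = y) \<noteq> (z = w \<or> z = r)" for z
    using odd_deg_sym_diff[of R K ends z] fR fK oddR[of z] K(4) by (simp add: PQ)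
  have oddQ: "odd (deg_in Q ends z) \<longleftrightarrow> (z = x \<or> z = v) \<noteq> (z = w \<or> z = r)" for z
    using odd_deg_sym_diff[of "B \<union> C" K ends z] fABC fK oddBC[of z] K(4) by (simp add: PQ)
  have sub: "P \<subseteq> E - D" "Q \<subseteq> E - D" "R' \<subseteq> E - D"
    using R(1) ABC_E HE K(1) by (auto simp: PQ R'_def)
  have un: "R' \<union> P \<union> Q = E - D"
    using K(1) R(1) unfolding N PQ R'_def by blast
  have cyc: "is_cycle V E ends (M \<union> S)"
    if "M \<subseteq> E - D" "S \<subseteq> D" "\<And>z. odd (deg_in M ends z) \<longleftrightarrow> odd (deg_in S ends z)" for M S
  proof -
    have "finite M" "finite S" "M \<inter> S = {}"
      using that(1,2) fin DE by (auto intro: finite_subset)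
    then show ?thesis
      using odd_deg_Un_disjoint[of M S ends] that DE unfolding is_cycle_def by blast
  qed
  have card_Un: "card (M \<union> S) = card M + card S" if "M \<subseteq> E - D" "S \<subseteq> D" for M S
    using that fin DE by (intro card_Un_disjoint) (auto intro: finite_subset)
  \<comment> \<open>The 8 is the share of the pentagon: two of its edges are covered once and three
    twice.\<close>
  have len: "card R' + card P + card Q + 8 = 2 * card V + 1"
  proof -
    have "card R' + card R = card (A \<union> C)"
      using R(1) fABC fR card_mono[of "A \<union> C" R] by (simp add: R'_def card_Diff_subset)
    moreover have "card P + card Q = card R + card (B \<union> C)"
      unfolding PQ using K(1) fR fABC by (intro card_sym_diff_exchange) auto
    moreover have "card (A \<union> C) = card A + card C" "card (B \<union> C) = card B + card C"
      using fABC disj by (auto intro: card_Un_disjoint)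
    moreover have "2 * card A + 5 = card V + 3" "2 * card B + 5 = card V + 1" "2 * card C + 5 = card V + 1"
    proof -
      have cards: "2 * card {e\<in>E - D. c e = k} + 5 = card V + card {z\<in>{w, x, y, u, v}. t z = k}"
        if "k < 3" for k
        using pole_class_card[OF mg circ, of c t k] pole that by (simp add: D_def)
      have "{z\<in>{w, x, y, u, v}. t z = t w} = {w, y, u}" "{z\<in>{w, x, y, u, v}. t z = t x} = {x}"
        "{z\<in>{w, x, y, u, v}. t z = t v} = {v}"
        using t by auto
      then show "2 * card A + 5 = card V + 3" "2 * card B + 5 = card V + 1" "2 * card C + 5 = card V + 1"
        using cards[OF lt(1)] cards[OF lt(2)] cards[OF lt(3)] vdist by (simp_all add: ABC)
    qed
    ultimately show ?thesis by linarith
  qed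
  have cR': "is_cycle V E ends (R' \<union> {uv})"
    using sub oddR' vdist by (intro cyc) (auto simp: D_def deg_in_def ends)
  have "r = x \<or> r = y \<or> r = v" using oddH K(2,3) by blast
  then show ?thesis
  proof (elim disjE)
    \<comment> \<open>\<open>P\<close> is odd at \<open>x\<close>, \<open>y\<close> and
      \<open>Q\<close> at \<open>v\<close>, \<open>w\<close>, so one edge closes each. The pentagon
      itself is added as a fourth cycle.\<close>
    assume r: "r = x"
    have "is_cycle V E ends ({} \<union> D)"
      using five_circuit_degree[OF circ] by (intro cyc) (auto simp: D_def)
    moreover have "is_cycle V E ends (P \<union> {xy})"
      using sub oddP r vdist by (intro cyc) (auto simp: D_def deg_in_def ends)
    moreover have "is_cycle V E ends (Q \<union> {vw})"
      using sub oddQ r vdist by (intro cyc) (auto simp: D_def deg_in_def ends)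
    ultimately have "cycle_cover V E ends [R' \<union> {uv}, {} \<union> D, P \<union> {xy}, Q \<union> {vw}]"
      using cR' un DE by (auto simp: cycle_cover_def D_def)
    moreover have "cover_length [R' \<union> {uv}, {} \<union> D, P \<union> {xy}, Q \<union> {vw}] = 2 * card V + 1"
      using card_Un[OF sub(3), of "{uv}"] card_Un[OF sub(1), of "{xy}"]
        card_Un[OF sub(2), of "{vw}"] len dist(2)
      by (simp add: cover_length_def D_def)
    ultimately show ?thesis by blast
  next
    \<comment> \<open>\<open>P\<close> is already even and can absorb the whole pentagon;
      \<open>Q\<close> is odd at \<open>x\<close>, \<open>y\<close>, \<open>v\<close>,
      \<open>w\<close>.\<close>
    assume r: "r = y"
    have "deg_in {xy, vw} ends z = count {#x, y#} z + count {#v, w#} z" for z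
      using dist(2) by (simp add: deg_in_def ends del: count_add_mset)
    then have cQ: "is_cycle V E ends (Q \<union> {xy, vw})"
      using sub oddQ r vdist by (intro cyc) (auto simp: D_def)
    have "is_cycle V E ends (P \<union> D)"
      using five_circuit_degree[OF circ] sub oddP r by (intro cyc) (auto simp: D_def)
    then have "cycle_cover V E ends [R' \<union> {uv}, P \<union> D, Q \<union> {xy, vw}]"
      using cR' cQ un DE by (auto simp: cycle_cover_def D_def)
    moreover have "cover_length [R' \<union> {uv}, P \<union> D, Q \<union> {xy, vw}] = 2 * card V + 1"
      using card_Un[OF sub(3), of "{uv}"] card_Un[OF sub(1), of "D"]
        card_Un[OF sub(2), of "{xy, vw}"] len dist(2)
      by (simp add: cover_length_def D_def)
    ultimately show ?thesis by blast
  next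
    \<comment> \<open>\<open>P\<close> is odd at \<open>y\<close>, \<open>v\<close> and
      \<open>Q\<close> at \<open>x\<close>, \<open>w\<close>. Both are closed by the longer arc of
      the pentagon; the shorter arcs would leave \<open>xy\<close> and \<open>vw\<close>
      uncovered.\<close>
    assume r: "r = v"
    have "deg_in {wx, xy, vw} ends z = count {#w, x#} z + (count {#x, y#} z + count {#v, w#} z)" for z
      using dist(2) by (simp add: deg_in_def ends del: count_add_mset)
    then have cP: "is_cycle V E ends (P \<union> {wx, xy, vw})"
      using sub oddP r vdist by (intro cyc) (auto simp: D_def)
    have "deg_in {xy, yu, uv, vw} ends z
        = count {#x, y#} z + (count {#y, u#} z + (count {#u, v#} z + count {#v, w#} z))" for z
      using dist(2) by (simp add: deg_in_def ends del: count_add_mset)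
    then have cQ: "is_cycle V E ends (Q \<union> {xy, yu, uv, vw})"
      using sub oddQ r vdist by (intro cyc) (auto simp: D_def)
    have "cycle_cover V E ends [R' \<union> {uv}, P \<union> {wx, xy, vw}, Q \<union> {xy, yu, uv, vw}]"
      using cR' cP cQ un DE by (auto simp: cycle_cover_def D_def)
    moreover have "cover_length [R' \<union> {uv}, P \<union> {wx, xy, vw}, Q \<union> {xy, yu, uv, vw}] = 2 * card V + 1"
      using card_Un[OF sub(3), of "{uv}"] card_Un[OF sub(1), of "{wx, xy, vw}"]
        card_Un[OF sub(2), of "{xy, yu, uv, vw}"] len dist(2)
      by (simp add: cover_length_def D_def)
    ultimately show ?thesis by blast
  qed
qed

text \<open>Three odd counts with sum 5 are 3, 1, 1. The three equal positions on a 5-cycle are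
  consecutive (\<open>P\<close>) or a pair plus an isolated one (\<open>Q\<close>), with five
  rotations each. Giving \<open>P\<close> and \<open>Q\<close> by equations lets callers keep the
  disjuncts folded.\<close>

lemma five_colours_pattern:
  fixes a b c d e :: nat
  assumes "a < 3" "b < 3" "c < 3" "d < 3" "e < 3"
    and "\<And>k. k < 3 \<Longrightarrow> odd ((of_bool (a = k) + of_bool (b = k) + of_bool (c = k) + of_bool (d = k)
          + of_bool (e = k)) :: nat)"
    and "P = (\<lambda>p q r s o'. q = p \<and> r = p \<and> s \<noteq> p \<and> o' \<noteq> p \<and> s \<noteq> o')"
    and "Q = (\<lambda>p q r s o'. r = p \<and> s = p \<and> q \<noteq> p \<and> o' \<noteq> p \<and> q \<noteq> o')"
  shows "P a b c d e \<or> P b c d e a \<or> P c d e a b \<or> P d e a b c \<or> P e a b c d \<or>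
         Q a b c d e \<or> Q b c d e a \<or> Q c d e a b \<or> Q d e a b c \<or> Q e a b c d"
proof -
  have less3: "k = 0 \<or> k = 1 \<or> k = 2" if "k < 3" for k :: nat
    using that by linarith
  show ?thesis
    using less3[OF assms(1)] less3[OF assms(2)] less3[OF assms(3)] less3[OF assms(4)]
      less3[OF assms(5)] assms(6)[of 0] assms(6)[of 1] assms(6)[of 2]
    unfolding assms(7,8) by (elim disjE; simp)
qed

lemma pole_imp_short_cover:
  assumes mg: "multigraph V E ends" and cub: "cubic V E ends"
    and ncol: "\<not> three_edge_colourable V E ends"
    and circ: "five_circuit V E ends vs es"
    and pole: "pole_colouring V E ends (set vs) (set es) c t"
  shows "\<exists>Cs. cycle_cover V E ends Cs \<and> cover_length Cs = 2 * card V + 1"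
proof -
  obtain w x y u v where vs: "vs = [w, x, y, u, v]"
    using circ by (auto simp: five_circuit_def length_Suc_conv eval_nat_numeral)
  obtain wx xy yu uv vw where es: "es = [wx, xy, yu, uv, vw]"
    using circ by (auto simp: five_circuit_def length_Suc_conv eval_nat_numeral)
  have fin: "finite E" using mg by (simp add: multigraph_def)
  have dist: "w \<noteq> x" "w \<noteq> y" "w \<noteq> u" "w \<noteq> v" "x \<noteq> y" "x \<noteq> u" "x \<noteq> v" "y \<noteq> u" "y \<noteq> v" "u \<noteq> v"
    using circ by (auto simp: five_circuit_def vs)
  define P where "P = (\<lambda>p q r s o' :: nat. q = p \<and> r = p \<and> s \<noteq> p \<and> o' \<noteq> p \<and> s \<noteq> o')"
  define Q where "Q = (\<lambda>p q r s o' :: nat. r = p \<and> s = p \<and> q \<noteq> p \<and> o' \<noteq> p \<and> q \<noteq> o')"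
  \<comment> \<open>Stated for an arbitrary base point, to be instantiated at all five
    rotations.\<close>
  have step: "\<not> P (t p) (t q) (t r) (t s) (t o') \<and> (Q (t p) (t q) (t r) (t s) (t o') \<longrightarrow> ?thesis)"
    if "five_circuit V E ends [p, q, r, s, o'] [e1, e2, e3, e4, e5]"
      "{p, q, r, s, o'} = set vs" "{e1, e2, e3, e4, e5} = set es" for p q r s o' e1 e2 e3 e4 e5
  proof -
    have pole': "pole_colouring V E ends {p, q, r, s, o'} {e1, e2, e3, e4, e5} c t"
      using pole that(2,3) by simp
    show ?thesis
      using consecutive_imp_colourable[OF fin that(1) pole']
        nonconsecutive_imp_short_cover[OF mg ncol that(1) pole'] ncol
      unfolding P_def Q_def by blast
  qed
  note circ0 = circ[unfolded vs es]
  note circ1 = five_circuit_rotate[OF circ0, simplified]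
  note circ2 = five_circuit_rotate[OF circ1, simplified]
  note circ3 = five_circuit_rotate[OF circ2, simplified]
  note circ4 = five_circuit_rotate[OF circ3, simplified]
  \<comment> \<open>A cubic graph has an even number of vertices, so the class count makes the
    number of ends of colour \<open>k\<close> odd.\<close>
  have "odd ((of_bool (t w = k) + of_bool (t x = k) + of_bool (t y = k) + of_bool (t u = k)
      + of_bool (t v = k)) :: nat)" if k: "k < 3" for k
  proof -
    have "card {z\<in>set vs. t z = k} = (\<Sum>z\<in>set vs. of_bool (t z = k))"
      by (simp add: of_bool_def sum.If_cases Int_def)
    also have "\<dots> = of_bool (t w = k) + of_bool (t x = k) + of_bool (t y = k) + of_bool (t u = k)
      + of_bool (t v = k)"
      using dist by (simp add: vs)
    finally show ?thesis
      using pole_class_card[OF mg circ pole k] cubic_card[OF mg cub] by presburger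
  qed
  moreover have "t w < 3" "t x < 3" "t y < 3" "t u < 3" "t v < 3"
    using pole by (auto simp: pole_colouring_def vs)
  ultimately have pat: "P (t w) (t x) (t y) (t u) (t v) \<or> P (t x) (t y) (t u) (t v) (t w) \<or>
      P (t y) (t u) (t v) (t w) (t x) \<or> P (t u) (t v) (t w) (t x) (t y) \<or>
      P (t v) (t w) (t x) (t y) (t u) \<or> Q (t w) (t x) (t y) (t u) (t v) \<or>
      Q (t x) (t y) (t u) (t v) (t w) \<or> Q (t y) (t u) (t v) (t w) (t x) \<or>
      Q (t u) (t v) (t w) (t x) (t y) \<or> Q (t v) (t w) (t x) (t y) (t u)"
    by (intro five_colours_pattern[OF _ _ _ _ _ _ P_def Q_def])
  have sets: "{w, x, y, u, v} = set vs" "{wx, xy, yu, uv, vw} = set es" "{x, y, u, v, w} = set vs" "{y, u, v, w, x} = set vs" "{u, v, w, x, y} = set vs"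
      "{v, w, x, y, u} = set vs" "{xy, yu, uv, vw, wx} = set es" "{yu, uv, vw, wx, xy} = set es"
      "{uv, vw, wx, xy, yu} = set es" "{vw, wx, xy, yu, uv} = set es"
    by (simp_all add: vs es insert_commute)
  show ?thesis
    using pat step[OF circ0 sets(1,2)] step[OF circ1 sets(3,7)] step[OF circ2 sets(4,8)]
      step[OF circ3 sets(5,9)] step[OF circ4 sets(6,10)]
    by argo
qed

section \<open>From a heavy pentagon to the bound\<close>

lemma pentagon_five_circuit:
  assumes mg: "multigraph V E ends" and D: "pentagon E ends D"
  obtains vs es where "five_circuit V E ends vs es" "set es = D"
proof -
  obtain f :: "nat \<Rightarrow> 'a" and g where fg: "inj_on f {0..<5}" "inj_on g {0..<5}" "D = g ` {0..<5}"
      "\<forall>i<5. ends (g i) = {#f i, f ((i + 1) mod 5)#}" and DE: "D \<subseteq> E"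
    using D unfolding pentagon_def by blast
  have "f i \<in> V" if "i < 5" for i
  proof -
    have "g i \<in> E" using that fg(3) DE by auto
    then have "set_mset (ends (g i)) \<subseteq> V" using mg by (simp add: multigraph_def)
    then show ?thesis using fg(4) that by simp
  qed
  moreover have upt: "[0..<5] = [0, 1, 2, 3, 4 :: nat]" by (simp add: upt_rec)
  have "distinct (map f [0..<5])" "distinct (map g [0..<5])" using fg by (simp_all add: distinct_map)
  moreover have "map ends (map g [0..<5]) = map2 (\<lambda>p q. {#p, q#}) (map f [0..<5]) (rotate1 (map f [0..<5]))"
    using fg(4) by (simp add: upt numeral_2_eq_2)
  ultimately have "five_circuit V E ends (map f [0..<5]) (map g [0..<5])"
    using fg(3) DE by (auto simp: five_circuit_def)
  then show ?thesis using that fg(3) by simp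
qed

theorem theorem7p3:
  fixes V :: "'v set" and E :: "'e set" and ends :: "'e \<Rightarrow> 'v multiset"
  assumes "snark V E ends"
    and "\<exists>D. heavy_pentagon V E ends D"
  shows "(\<exists>Cs. cycle_cover V E ends Cs \<and> real (cover_length Cs) \<le> 4 / 3 * real (card E) + 1) \<and>
         real (scc V E ends) \<le> 4 / 3 * real (card E) + 1"
proof -
  have mg: "multigraph V E ends" and cub: "cubic V E ends"
    and ncol: "\<not> three_edge_colourable V E ends"
    using assms(1) by (auto simp: snark_def)
  obtain D e u v where D: "pentagon E ends D" "e \<in> D" "ends e = {#u, v#}"
      "three_edge_colourable (V - {u, v}) (del_edges E ends {u, v}) ends"
    using assms(2) unfolding heavy_pentagon_def by blast
  obtain vs es where circ: "five_circuit V E ends vs es" "set es = D"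
    using pentagon_five_circuit[OF mg D(1)] by blast
  have fin: "finite D" by (metis circ(2) List.finite_set)
  \<comment> \<open>An end of \<open>e\<close> has positive degree in \<open>D\<close>, while
    vertices off the circuit have degree 0.\<close>
  have "z \<in> set vs" if "z \<in># ends e" for z
  proof (rule ccontr)
    assume "z \<notin> set vs"
    then have "deg_in D ends z = 0" using five_circuit_degree[OF circ(1), of z] circ(2) by simp
    then have "count (ends e) z = 0" using D(2) fin by (simp add: deg_in_def)
    then show False using that by (simp add: count_eq_zero_iff)
  qed
  then have "u \<in> set vs" "v \<in> set vs" using D(3) by simp_all
  then obtain c t where "pole_colouring V E ends (set vs) (set es) c t"
    using pole_colouring_exists[OF mg cub circ(1) _ _ D(4)] by blast
  then obtain Cs where Cs: "cycle_cover V E ends Cs" "cover_length Cs = 2 * card V + 1"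
    using pole_imp_short_cover[OF mg cub ncol circ(1)] by blast
  \<comment> \<open>Hence \<open>2 * card V\<close> equals four thirds of \<open>card E\<close>, and
    the cover found meets the bound with equality.\<close>
  have "2 * card E = 3 * card V" using cubic_card[OF mg cub] .
  then have bound: "real (cover_length Cs) \<le> 4 / 3 * real (card E) + 1"
    using Cs(2) by simp
  have "scc V E ends \<le> cover_length Cs"
    unfolding scc_def by (rule Least_le) (use Cs(1) in blast)
  then have "real (scc V E ends) \<le> 4 / 3 * real (card E) + 1" using bound by simp
  then show ?thesis using Cs(1) bound by blast
qed

end
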